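(* Let $(X,X_+)$ be a pre-Riesz space with $n = \dim X < \infty$. Then the following assertions hold: (a) The number of band projections on $X$ is equal to $2^m$ for some $m \in \{0,\dots,n\}$. (b) For this number $m$, we have $m = n$ if and only if $X$ is an Archimedean vector lattice.
   Context: An ordered vector space $(X,X_+)$ is a real vector space $X$ with a non-empty set $X_+ \subseteq X$ such that $X_+ \cap (-X_+) = \{0\}$ and $\alpha X_+ + \beta X_+ \subseteq X_+$ for all $\alpha,\beta \in [0,\infty)$; one writes $x \le y$ if $y - x \in X_+$. It is Archimedean if, for all $x,y \in X$, $nx \le y$ for all $n \in \{1,2,\dots\}$ implies $x \le 0$. It is a vector lattice if any two elements have a supremum and an infimum. It is a pre-Riesz space if for every non-empty finite set $A \subseteq X$ and every $x \in X$: if every upper bound of $x + A$ is an upper bound of $A$, then $x \in X_+$. Two elements $x,y \in X$ are disjoint, $x \perp y$, if the sets $\{x+y,-x-y\}$ and $\{x-y,y-x\}$ have the same set of upper bounds in $X$. For $S \subseteq X$, $S^\perp := \{x \in X : x \perp s \text{ for all } s \in S\}$ (in a pre-Riesz space this is always a vector subspace). A set $B \subseteq X$ is a band if $B = B^{\perp\perp} := (B^\perp)^\perp$. A band $B$ is a projection band if $X = B \oplus B^\perp$. A linear projection $P: X \to X$ is a band projection if there is a projection band $B$ such that $P$ is the projection onto $B$ along $B^\perp$. *)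

theory Defs
  imports Complex_Main "HOL-Library.Lub_Glb"
begin

text \<open>
  An ordered vector space \<open>(X, X\<^sub>+)\<close> is a type of class \<^class>\<open>ordered_real_vector\<close>, with
  \<open>X\<^sub>+ = {x. 0 \<le> x}\<close>; the class axioms say precisely that this set is a cone
  with \<open>X\<^sub>+ \<inter> -X\<^sub>+ = {0}\<close> and that \<open>x \<le> y\<close> means \<open>y - x \<in> X\<^sub>+\<close>.
  The set of upper bounds of \<open>A\<close> in \<open>X\<close> is \<open>ubs UNIV A\<close>.
\<close>

definition archimedean :: "'a::ordered_real_vector itself \<Rightarrow> bool"
  where "archimedean _ \<longleftrightarrow>
    (\<forall>x y::'a. (\<forall>n::nat. 1 \<le> n \<longrightarrow> real n *\<^sub>R x \<le> y) \<longrightarrow> x \<le> 0)"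

definition vector_lattice :: "'a::ordered_real_vector itself \<Rightarrow> bool"
  where "vector_lattice _ \<longleftrightarrow>
    (\<forall>x y::'a. (\<exists>s. isLub UNIV {x, y} s) \<and> (\<exists>i. isGlb UNIV {x, y} i))"

definition pre_Riesz :: "'a::ordered_real_vector itself \<Rightarrow> bool"
  where "pre_Riesz _ \<longleftrightarrow>
    (\<forall>(A::'a set) x. finite A \<and> A \<noteq> {} \<and> ubs UNIV ((+) x ` A) \<subseteq> ubs UNIV A \<longrightarrow> 0 \<le> x)"

definition finite_dim :: "'a::real_vector itself \<Rightarrow> bool"
  where "finite_dim _ \<longleftrightarrow> (\<exists>S::'a set. finite S \<and> span S = UNIV)"

definition disj_elems :: "'a::ordered_real_vector \<Rightarrow> 'a \<Rightarrow> bool"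
  where "disj_elems x y \<longleftrightarrow> ubs UNIV {x + y, - x - y} = ubs UNIV {x - y, y - x}"

definition disj_compl :: "'a::ordered_real_vector set \<Rightarrow> 'a set"
  where "disj_compl S = {x. \<forall>s\<in>S. disj_elems x s}"

definition band :: "'a::ordered_real_vector set \<Rightarrow> bool"
  where "band B \<longleftrightarrow> B = disj_compl (disj_compl B)"

definition direct_sum_decomp :: "'a::real_vector set \<Rightarrow> 'a set \<Rightarrow> bool"
  where "direct_sum_decomp U V \<longleftrightarrow>
    subspace U \<and> subspace V \<and> U \<inter> V = {0} \<and> (\<forall>x. \<exists>u\<in>U. \<exists>v\<in>V. x = u + v)"

definition projection_band :: "'a::ordered_real_vector set \<Rightarrow> bool"
  where "projection_band B \<longleftrightarrow> band B \<and> direct_sum_decomp B (disj_compl B)"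

definition projection_onto_along ::
    "('a::real_vector \<Rightarrow> 'a) \<Rightarrow> 'a set \<Rightarrow> 'a set \<Rightarrow> bool"
  where "projection_onto_along P U V \<longleftrightarrow>
    linear P \<and> P \<circ> P = P \<and> range P = U \<and> {x. P x = 0} = V"

definition band_projection :: "('a::ordered_real_vector \<Rightarrow> 'a) \<Rightarrow> bool"
  where "band_projection P \<longleftrightarrow>
    (\<exists>B. projection_band B \<and> projection_onto_along P B (disj_compl B))"

end

theory Submission
  imports Defs
begin

text \<open>
  Pre-Riesz spaces are directed, and in a directed space the band projections are exactly the linear
  projections \<open>P\<close> with \<open>0 \<le> P \<le> I\<close>. These commute, so they form a Boolean algebra. An orthogonal
  family of nonzero such projections of maximal size \<open>m \<le> n\<close> sums to \<open>I\<close> and consists of atoms,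
  whence every band projection is the sum of a unique subfamily. If \<open>m = n\<close>, a positive vector from
  each range gives a basis for which the cone is the nonnegative orthant. Conversely, in an
  Archimedean vector lattice a maximal family of pairwise disjoint positive vectors is such a basis,
  and its \<open>2\<^sup>n\<close> coordinate projections are band projections.
\<close>

section \<open>Auxiliary facts on upper bounds and on dimension\<close>

lemma mem_ubs_pair: "z \<in> ubs UNIV {a, b} \<longleftrightarrow> a \<le> z \<and> b \<le> z"
  by (auto simp: ubs_def isUb_def setle_def)

lemma disj_elems_commute: "disj_elems x y \<longleftrightarrow> disj_elems y x"
  unfolding disj_elems_def
  by (simp add: add.commute[of y x] minus_diff_commute[of y x] insert_commute[of "y - x"])

lemma isLub_pair:
  "isLub UNIV {a, b} s \<longleftrightarrow> a \<le> s \<and> b \<le> s \<and> (\<forall>z. a \<le> z \<and> b \<le> z \<longrightarrow> s \<le> z)"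
  by (auto simp: isLub_def leastP_def isUb_def setle_def setge_def)

lemma isGlb_pair:
  "isGlb UNIV {a, b} s \<longleftrightarrow> s \<le> a \<and> s \<le> b \<and> (\<forall>z. z \<le> a \<and> z \<le> b \<longrightarrow> z \<le> s)"
  by (auto simp: isGlb_def greatestP_def isLb_def setle_def setge_def)

lemma nonneg_if_double_nonneg:
  fixes x :: "'a::ordered_real_vector"
  assumes "0 \<le> x + x"
  shows "0 \<le> x"
proof -
  have "0 \<le> (1/2) *\<^sub>R (x + x)"
    using assms by (intro scaleR_nonneg_nonneg) auto
  also have "(1/2) *\<^sub>R (x + x) = x"
    by (simp add: scaleR_add_right flip: scaleR_add_left)
  finally show ?thesis .
qed

lemma finite_dim_independent_card_le:
  fixes S :: "'a::real_vector set"
  assumes "finite_dim TYPE('a)" "independent S"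
  shows "finite S" "card S \<le> dim (UNIV :: 'a set)"
proof -
  obtain T :: "'a set" where T: "finite T" "span T = UNIV"
    using assms unfolding finite_dim_def by blast
  obtain B :: "'a set" where B: "independent B" "UNIV \<subseteq> span B" "card B = dim (UNIV::'a set)"
    using basis_exists by blast
  have "finite B"
    using independent_span_bound[OF T(1) B(1)] T by auto
  then show "finite S" "card S \<le> dim (UNIV :: 'a set)"
    using independent_span_bound[of B S] B assms by auto
qed

lemma finite_dim_independent_spans:
  fixes S :: "'a::real_vector set"
  assumes "finite_dim TYPE('a)" "independent S" "card S = dim (UNIV :: 'a set)"
  shows "span S = UNIV"
proof (rule ccontr)
  assume "span S \<noteq> UNIV"
  then obtain x where x: "x \<notin> span S" by blast
  then have "independent (insert x S)"
    using assms by (simp add: independent_insertI)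
  moreover have "x \<notin> S" using x span_base by blast
  ultimately show False
    using finite_dim_independent_card_le[OF assms(1)] assms
    by (metis card_insert_disjoint finite_insert not_less_eq_eq order_refl)
qed

section \<open>Band projections as order bounded projections\<close>

text \<open>The order bounds mention no disjoint complement, so closure under complements, products
  and orthogonal sums can be checked on positive vectors alone.\<close>

definition order_projection :: "('a::ordered_real_vector \<Rightarrow> 'a) \<Rightarrow> bool"
  where "order_projection P \<longleftrightarrow>
    linear P \<and> (\<forall>x. P (P x) = P x) \<and> (\<forall>x\<ge>0. 0 \<le> P x \<and> P x \<le> x)"

lemma order_projectionD:
  assumes "order_projection P"
  shows "linear P" "P (P x) = P x" "0 \<le> x \<Longrightarrow> 0 \<le> P x" "0 \<le> x \<Longrightarrow> P x \<le> x"
  using assms by (auto simp: order_projection_def)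

lemma order_projection_mono:
  assumes "order_projection P" "x \<le> y"
  shows "P x \<le> P y"
  using order_projectionD(3)[OF assms(1), of "y - x"] assms(2)
  by (simp add: linear_diff[OF order_projectionD(1)[OF assms(1)]])

lemma order_projection_compl:
  assumes "order_projection P"
  shows "order_projection (\<lambda>x. x - P x)"
proof -
  note P = order_projectionD[OF assms]
  show ?thesis
    unfolding order_projection_def
    using P by (auto intro!: linear_compose_sub linear_ident simp: linear_diff[OF P(1)])
qed

text \<open>Applying \<open>P\<close> and \<open>I - P\<close> to an upper bound of \<open>{x + y, -x - y}\<close> bounds both components.\<close>

lemma order_projection_disj:
  assumes P: "order_projection P" and x: "P x = x" and y: "P y = 0"
  shows "disj_elems x y"
proof -
  note lin = order_projectionD(1)[OF P]
  have key: "x - v \<le> z \<and> v - x \<le> z" if v: "P v = 0" and z: "x + v \<le> z" "- x - v \<le> z" for v z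
  proof -
    have a: "x \<le> P z" "- x \<le> P z"
      using order_projection_mono[OF P z(1)] order_projection_mono[OF P z(2)]
      by (simp_all add: linear_add[OF lin] linear_diff[OF lin] linear_neg[OF lin] x v)
    have b: "v \<le> z - P z" "- v \<le> z - P z"
      using order_projection_mono[OF order_projection_compl[OF P] z(1)]
        order_projection_mono[OF order_projection_compl[OF P] z(2)]
      by (simp_all add: linear_add[OF lin] linear_diff[OF lin] linear_neg[OF lin] x v)
    from add_mono[OF a(1) b(2)] add_mono[OF a(2) b(1)] show ?thesis by simp
  qed
  have "P (- y) = 0" using y by (simp add: linear_neg[OF lin])
  then have "x + y \<le> z \<and> - x - y \<le> z \<longleftrightarrow> x - y \<le> z \<and> y - x \<le> z" for z
    using key[OF y, of z] key[of "-y" z] by (auto simp: minus_diff_commute[of y x])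
  then show ?thesis
    unfolding disj_elems_def set_eq_iff mem_ubs_pair by blast
qed

text \<open>A common bound of \<open>x\<close> and \<open>- x\<close> is itself positive, so this
  form of directedness makes the cone generating. Linear maps are then determined by their values on
  positive vectors.\<close>

locale directed_ovs =
  fixes ty :: "'a::ordered_real_vector itself"
  assumes symmetric_bound: "\<exists>z::'a. x \<le> z \<and> - x \<le> z"
begin

lemma nonneg_diff_cases:
  obtains a b :: 'a where "0 \<le> a" "0 \<le> b" "x = a - b"
proof -
  obtain z where z: "x \<le> z" "- x \<le> z" using symmetric_bound by blast
  have "0 \<le> z + z" using add_mono[OF z] by simp
  then have "0 \<le> z" by (rule nonneg_if_double_nonneg)
  moreover have "0 \<le> z - x" "x = z - (z - x)" using z by auto
  ultimately show ?thesis using that by blast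
qed

lemma linear_eq_on_nonneg:
  fixes f g :: "'a \<Rightarrow> 'a"
  assumes "linear f" "linear g" "\<And>x. 0 \<le> x \<Longrightarrow> f x = g x"
  shows "f x = g x"
  by (rule nonneg_diff_cases[of x]) (simp add: assms linear_diff)

text \<open>If \<open>w\<close> is disjoint from \<open>P w\<close>, an upper bound of
  \<open>w - P w\<close> and its negative that \<open>P\<close> annihilates also bounds
  \<open>w + P w\<close> and its negative. Applying \<open>P\<close> leaves \<open>2 P w\<close>
  squeezed between 0 and 0.\<close>

lemma disj_compl_range:
  assumes P: "order_projection (P :: 'a \<Rightarrow> 'a)"
  shows "disj_compl (range P) = {x. P x = 0}"
proof (intro equalityI subsetI)
  note lin = order_projectionD(1)[OF P]
  fix w assume "w \<in> disj_compl (range P)"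
  then have d: "disj_elems w (P w)" unfolding disj_compl_def by blast
  let ?v = "w - P w"
  obtain z where z: "?v \<le> z" "- ?v \<le> z" using symmetric_bound by blast
  \<comment> \<open>\<open>I - P\<close> is monotone and fixes \<open>?v\<close>, so
    \<open>?z\<close> still bounds both signs of \<open>?v\<close>, while
    \<open>P ?z = 0\<close>.\<close>
  let ?z = "z - P z"
  have "?v \<le> ?z" "- ?v \<le> ?z"
    using order_projection_mono[OF order_projection_compl[OF P] z(1)]
      order_projection_mono[OF order_projection_compl[OF P] z(2)] order_projectionD(2)[OF P]
    by (simp_all add: linear_diff[OF lin])
  then have "?z \<in> ubs UNIV {w + P w, - w - P w}"
    using d unfolding disj_elems_def by (simp add: mem_ubs_pair)
  then have "w + P w \<le> ?z" "- w - P w \<le> ?z"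
    by (simp_all add: mem_ubs_pair)
  from this[THEN order_projection_mono[OF P]]
  have le: "P w + P w \<le> 0" "- P w - P w \<le> 0"
    by (simp_all only: linear_diff[OF lin] linear_add[OF lin] linear_neg[OF lin]
        order_projectionD(2)[OF P] diff_self)
  have "0 \<le> P w + P w" using add_left_mono[OF le(2), of "P w + P w"] by simp
  with le(1)
  have "P w + P w = 0" by (rule order_antisym)
  then have "2 *\<^sub>R P w = 0" by (simp add: scaleR_2)
  then show "w \<in> {x. P x = 0}" by simp
next
  fix w assume "w \<in> {x. P x = 0}"
  then show "w \<in> disj_compl (range P)"
    using order_projection_disj[OF P] order_projectionD(2)[OF P] disj_elems_commute
    unfolding disj_compl_def by blast
qed

text \<open>Passing from \<open>P\<close> to \<open>I - P\<close> swaps range and kernel.\<close>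

lemma disj_compl_kernel:
  assumes P: "order_projection (P :: 'a \<Rightarrow> 'a)"
  shows "disj_compl {x. P x = 0} = range P"
proof -
  note lin = order_projectionD(1)[OF P]
  have "range (\<lambda>x. x - P x) = {x. P x = 0}"
    using order_projectionD(2)[OF P]
    by (auto simp: linear_diff[OF lin] image_iff) (metis diff_zero)
  moreover have "{x. x - P x = 0} = range P"
    using order_projectionD(2)[OF P] by (auto simp: image_iff)
  ultimately show ?thesis
    using disj_compl_range[OF order_projection_compl[OF P]] by simp
qed

text \<open>An order projection has range and kernel that are disjoint complements of each other.
  Conversely, for positive \<open>x\<close> the parts \<open>P x\<close> and \<open>x - P x\<close>
  are disjoint; as \<open>x\<close> bounds both signs of their sum, it bounds both signs of their
  difference, which gives the two order bounds.\<close>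

lemma band_projection_iff_order_projection:
  fixes P :: "'a \<Rightarrow> 'a"
  shows "band_projection P \<longleftrightarrow> order_projection P"
proof
  assume P: "order_projection P"
  note lin = order_projectionD(1)[OF P]
  have idem: "P (P x) = P x" for x using order_projectionD(2)[OF P] .
  have "\<exists>u\<in>range P. \<exists>v\<in>{x. P x = 0}. x = u + v" for x
    by (intro bexI[of _ "P x"] bexI[of _ "x - P x"]) (auto simp: linear_diff[OF lin] idem)
  moreover have "range P \<inter> {x. P x = 0} = {0}"
    using idem linear_0[OF lin] by (auto simp: image_iff)
  ultimately have "direct_sum_decomp (range P) {x. P x = 0}"
    unfolding direct_sum_decomp_def
    using linear_subspace_image[OF lin subspace_UNIV] linear_subspace_kernel[OF lin] by simp
  then have "projection_band (range P)"
    unfolding projection_band_def band_def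
    by (simp add: disj_compl_range[OF P] disj_compl_kernel[OF P])
  then show "band_projection P"
    unfolding band_projection_def projection_onto_along_def
    using lin idem disj_compl_range[OF P] by (auto intro!: exI[of _ "range P"])
next
  assume "band_projection P"
  then have lin: "linear P" and "P \<circ> P = P" and ker: "{x. P x = 0} = disj_compl (range P)"
    unfolding band_projection_def projection_onto_along_def by auto
  then have idem: "P (P x) = P x" for x by (metis comp_apply)
  have "0 \<le> P x \<and> P x \<le> x" if "0 \<le> x" for x
  proof -
    have "P (x - P x) = 0" by (simp add: linear_diff[OF lin] idem)
    then have "disj_elems (x - P x) (P x)"
      using ker unfolding disj_compl_def by blast
    moreover have "- x \<le> x" using that by (meson neg_le_0_iff_le order_trans)
    then have "x \<in> ubs UNIV {(x - P x) + P x, - (x - P x) - P x}"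
      by (simp add: mem_ubs_pair)
    ultimately have le: "(x - P x) - P x \<le> x" "P x - (x - P x) \<le> x"
      unfolding disj_elems_def by (simp_all add: mem_ubs_pair)
    from le(1) have "0 \<le> P x + P x" by (simp add: algebra_simps)
    moreover from le(2) have "0 \<le> (x - P x) + (x - P x)" by (simp add: algebra_simps)
    ultimately show ?thesis using nonneg_if_double_nonneg[of "P x"] nonneg_if_double_nonneg[of "x - P x"] by simp
  qed
  then show "order_projection P"
    unfolding order_projection_def using lin idem by simp
qed

text \<open>\<open>Q\<close> preserves the range of every order projection \<open>R\<close>: for
  positive \<open>x\<close>, \<open>Q (R x)\<close> lies between 0 and \<open>R x\<close>, and the
  monotone map \<open>I - R\<close> sends both ends to 0.\<close>

lemma order_projection_commute:
  fixes P Q :: "'a \<Rightarrow> 'a"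
  assumes P: "order_projection P" and Q: "order_projection Q"
  shows "P (Q x) = Q (P x)"
proof -
  have *: "R (Q (R x)) = Q (R x)" if R: "order_projection R" for R :: "'a \<Rightarrow> 'a" and x
  proof (rule linear_eq_on_nonneg[where x = x])
    note linR = order_projectionD(1)[OF R] and linQ = order_projectionD(1)[OF Q]
    show "linear (\<lambda>x. R (Q (R x)))" "linear (\<lambda>x. Q (R x))"
      using linear_compose[OF linR linQ] linear_compose[OF linear_compose[OF linR linQ] linR]
      by (simp_all add: o_def)
    fix x :: 'a assume "0 \<le> x"
    then have "0 \<le> R x" by (rule order_projectionD[OF R])
    then have "0 \<le> Q (R x)" "Q (R x) \<le> R x" by (rule order_projectionD[OF Q])+
    from order_projectionD(4)[OF R this(1)]
      order_projection_mono[OF order_projection_compl[OF R] this(2)]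
    show "R (Q (R x)) = Q (R x)"
      by (simp add: order_projectionD(2)[OF R])
  qed
  \<comment> \<open>For \<open>I - P\<close> the invariance says that \<open>Q\<close> preserves the
    kernel of \<open>P\<close>, so \<open>PQ = PQP\<close>; for \<open>P\<close> itself it says
    \<open>QP = PQP\<close>.\<close>
  have "P (Q (x - P x)) = 0"
    using *[OF order_projection_compl[OF P], of x] by simp
  then have "P (Q x) = P (Q (P x))"
    by (simp add: linear_diff[OF order_projectionD(1)[OF P]]
        linear_diff[OF order_projectionD(1)[OF Q]])
  then show ?thesis using *[OF P] by simp
qed

lemma order_projection_comp:
  fixes P Q :: "'a \<Rightarrow> 'a"
  assumes P: "order_projection P" and Q: "order_projection Q"
  shows "order_projection (\<lambda>x. P (Q x))"
  unfolding order_projection_def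
proof (intro conjI allI impI)
  show "linear (\<lambda>x. P (Q x))"
    using linear_compose[OF order_projectionD(1)[OF Q] order_projectionD(1)[OF P]]
    by (simp add: o_def)
  show "P (Q (P (Q x))) = P (Q x)" for x
    by (simp add: order_projection_commute[OF P Q] order_projectionD(2)[OF P]
        order_projectionD(2)[OF Q])
  show "0 \<le> P (Q x)" "P (Q x) \<le> x" if "0 \<le> x" for x
    using that order_projectionD(3,4)[OF P] order_projectionD(3,4)[OF Q] by (meson order_trans)+
qed

end

section \<open>Orthogonal families of order projections\<close>

text \<open>Excluding the zero map is what bounds the size by the dimension and makes different
  subfamilies have different sums.\<close>

definition orth_family :: "('a::ordered_real_vector \<Rightarrow> 'a) set \<Rightarrow> bool"
  where "orth_family A \<longleftrightarrow>
    finite A \<and> (\<forall>P\<in>A. order_projection P \<and> P \<noteq> (\<lambda>_. 0)) \<and>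
    (\<forall>P\<in>A. \<forall>Q\<in>A. P \<noteq> Q \<longrightarrow> (\<forall>x. P (Q x) = 0))"

lemma orth_familyD:
  assumes "orth_family A"
  shows "finite A" "P \<in> A \<Longrightarrow> order_projection P" "P \<in> A \<Longrightarrow> P \<noteq> (\<lambda>_. 0)"
    "P \<in> A \<Longrightarrow> Q \<in> A \<Longrightarrow> P \<noteq> Q \<Longrightarrow> P (Q x) = 0"
  using assms by (auto simp: orth_family_def)

text \<open>Applying a member to a partial sum tests whether it occurs there; idempotence of such
  sums and injectivity of the subset map both rest on this.\<close>

lemma orth_family_apply_sum:
  assumes A: "orth_family A" and T: "T \<subseteq> A" and E: "E \<in> A"
  shows "E (\<Sum>F\<in>T. F x) = (if E \<in> T then E x else 0)"
proof -
  have fin: "finite T" using orth_familyD(1)[OF A] T finite_subset by blast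
  have "E (\<Sum>F\<in>T. F x) = (\<Sum>F\<in>T. E (F x))"
    by (rule linear_sum[OF order_projectionD(1)[OF orth_familyD(2)[OF A E]]])
  also have "\<dots> = (\<Sum>F\<in>T. if F = E then E x else 0)"
    using orth_familyD(4)[OF A E] T order_projectionD(2)[OF orth_familyD(2)[OF A E]]
    by (intro sum.cong) auto
  finally show ?thesis using fin by simp
qed

text \<open>The remainder after subtracting part of the sum stays positive, so a further member
  \<open>E\<close> maps it below itself; by orthogonality that image is just
  \<open>E x\<close>.\<close>

lemma orth_family_sum_le:
  assumes A: "orth_family A" and T: "T \<subseteq> A" and x: "0 \<le> x"
  shows "(\<Sum>E\<in>T. E x) \<le> x"
proof -
  have "finite T" using orth_familyD(1)[OF A] T finite_subset by blast
  then show ?thesis using T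
  proof (induction T rule: finite_induct)
    case (insert E T)
    then have E: "order_projection E" using orth_familyD(2)[OF A] by simp
    have "E (x - (\<Sum>F\<in>T. F x)) \<le> x - (\<Sum>F\<in>T. F x)"
      using insert by (intro order_projectionD(4)[OF E]) simp
    then have "E x \<le> x - (\<Sum>F\<in>T. F x)"
      using orth_family_apply_sum[OF A, of T E x] insert
      by (simp add: linear_diff[OF order_projectionD(1)[OF E]])
    then show ?case using insert by (simp add: le_diff_eq)
  qed (use x in simp)
qed

lemma orth_family_sum:
  assumes A: "orth_family A" and T: "T \<subseteq> A"
  shows "order_projection (\<lambda>x. \<Sum>E\<in>T. E x)"
  unfolding order_projection_def
proof (intro conjI allI impI)
  show "linear (\<lambda>x. \<Sum>E\<in>T. E x)"
    using T orth_familyD(2)[OF A] order_projectionD(1) by (intro linear_compose_sum) blast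
  show "(\<Sum>E\<in>T. E (\<Sum>F\<in>T. F x)) = (\<Sum>E\<in>T. E x)" for x
    using T by (intro sum.cong) (auto simp: orth_family_apply_sum[OF A T])
  show "0 \<le> (\<Sum>E\<in>T. E x)" if "0 \<le> x" for x
    using T orth_familyD(2)[OF A] order_projectionD(3) that by (intro sum_nonneg) blast
  show "(\<Sum>E\<in>T. E x) \<le> x" if "0 \<le> x" for x
    using orth_family_sum_le[OF A T that] .
qed

lemma (in directed_ovs) order_projection_nonneg_fixed:
  assumes P: "order_projection (P :: 'a \<Rightarrow> 'a)" and "P \<noteq> (\<lambda>_. 0)"
  shows "\<exists>e. 0 \<le> e \<and> e \<noteq> 0 \<and> P e = e"
proof -
  have "\<exists>x\<ge>0. P x \<noteq> 0"
  proof (rule ccontr)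
    assume "\<not> ?thesis"
    then have "P x = 0" for x
      using linear_eq_on_nonneg[OF order_projectionD(1)[OF P] linear_zero] by auto
    then show False using assms(2) by auto
  qed
  then show ?thesis
    using order_projectionD(2,3)[OF P] by blast
qed

text \<open>Applying a member \<open>E\<close> to a linear relation annihilates every term except
  that of \<open>e E\<close>.\<close>

lemma orth_family_independent:
  assumes A: "orth_family A"
    and e: "\<And>E. E \<in> A \<Longrightarrow> e E \<noteq> 0" "\<And>E. E \<in> A \<Longrightarrow> E (e E) = e E"
  shows "inj_on e A" "independent (e ` A)"
proof -
  have orth: "E (e F) = 0" if "E \<in> A" "F \<in> A" "E \<noteq> F" for E F
    using orth_familyD(4)[OF A that] e(2)[OF that(2)] by metis
  show inj: "inj_on e A"
    using orth e by (metis inj_onI)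
  show "independent (e ` A)"
  proof (rule independent_if_scalars_zero)
    show "finite (e ` A)" using orth_familyD(1)[OF A] by simp
    fix f x assume sum: "(\<Sum>x\<in>e ` A. f x *\<^sub>R x) = 0" and "x \<in> e ` A"
    then obtain E where E: "E \<in> A" "x = e E" by auto
    note lin = order_projectionD(1)[OF orth_familyD(2)[OF A E(1)]]
    have "0 = E (\<Sum>F\<in>A. f (e F) *\<^sub>R e F)"
      using sum by (simp add: sum.reindex[OF inj] linear_0[OF lin])
    also have "\<dots> = (\<Sum>F\<in>A. f (e F) *\<^sub>R E (e F))"
      by (simp add: linear_sum[OF lin] linear_scale[OF lin])
    also have "\<dots> = (\<Sum>F\<in>A. if F = E then f (e E) *\<^sub>R e E else 0)"
      using orth E e by (intro sum.cong) auto
    also have "\<dots> = f (e E) *\<^sub>R e E" using E orth_familyD(1)[OF A] by simp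
    finally show "f x = 0" using e(1) E by simp
  qed
qed

section \<open>Maximal orthogonal families in finite dimension\<close>

locale finite_dim_directed_ovs = directed_ovs ty for ty :: "'a::ordered_real_vector itself" +
  assumes finite_dim: "finite_dim TYPE('a)"
begin

lemma orth_family_card_le:
  assumes A: "orth_family (A :: ('a \<Rightarrow> 'a) set)"
  shows "card A \<le> dim (UNIV :: 'a set)"
proof -
  have "\<forall>E\<in>A. \<exists>e. 0 \<le> e \<and> e \<noteq> 0 \<and> E e = e"
    using order_projection_nonneg_fixed[OF orth_familyD(2,3)[OF A]] by blast
  then obtain e where e: "\<And>E. E \<in> A \<Longrightarrow> e E \<noteq> 0" "\<And>E. E \<in> A \<Longrightarrow> E (e E) = e E" by metis
  show ?thesis
    using finite_dim_independent_card_le(2)[OF finite_dim orth_family_independent(2)[OF A e]]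
    by (simp add: card_image[OF orth_family_independent(1)[OF A e]])
qed

lemma obtain_maximal_orth_family:
  obtains A where "orth_family (A :: ('a \<Rightarrow> 'a) set)"
    "\<And>A'. orth_family (A' :: ('a \<Rightarrow> 'a) set) \<Longrightarrow> card A' \<le> card A"
proof -
  have "orth_family ({} :: ('a \<Rightarrow> 'a) set)" by (simp add: orth_family_def)
  moreover have "\<forall>A. orth_family (A :: ('a \<Rightarrow> 'a) set) \<longrightarrow> card A < Suc (dim (UNIV :: 'a set))"
    using orth_family_card_le by (simp add: less_Suc_eq_le)
  ultimately show ?thesis
    using ex_has_greatest_nat[of orth_family "{} :: ('a \<Rightarrow> 'a) set" card] that by blast
qed

text \<open>The remainder \<open>R = I - sum\<close> is an order projection orthogonal to all
  members, so if nonzero it could be added to the family.\<close>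

lemma maximal_orth_family_sum:
  assumes A: "orth_family (A :: ('a \<Rightarrow> 'a) set)"
    and max: "\<And>A'. orth_family (A' :: ('a \<Rightarrow> 'a) set) \<Longrightarrow> card A' \<le> card A"
  shows "(\<Sum>E\<in>A. E x) = x"
proof -
  define R where "R = (\<lambda>x. x - (\<Sum>E\<in>A. E x))"
  have R: "order_projection R"
    unfolding R_def by (rule order_projection_compl[OF orth_family_sum[OF A order_refl]])
  have ER: "E (R x) = 0" if "E \<in> A" for E x
    using orth_family_apply_sum[OF A order_refl that] that
    by (simp add: R_def linear_diff[OF order_projectionD(1)[OF orth_familyD(2)[OF A that]]])
  have RE: "R (E x) = 0" if "E \<in> A" for E x
    using order_projection_commute[OF R orth_familyD(2)[OF A that]] ER[OF that] by simp
  have "R = (\<lambda>_. 0)"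
  proof (rule ccontr)
    assume nz: "R \<noteq> (\<lambda>_. 0)"
    \<comment> \<open>Members annihilate the range of \<open>R\<close>; were \<open>R\<close> a
      member, \<open>R = R R\<close> would vanish.\<close>
    have "R \<notin> A"
      using ER nz order_projectionD(2)[OF R] by metis
    moreover have "orth_family (insert R A)"
      unfolding orth_family_def using orth_familyD[OF A] R nz ER RE by blast
    ultimately show False
      using max[of "insert R A"] orth_familyD(1)[OF A] by simp
  qed
  then show ?thesis unfolding R_def by (metis right_minus_eq)
qed

text \<open>If \<open>P\<close> split a member \<open>E\<close> properly, replacing \<open>E\<close> by \<open>PE\<close> and \<open>E - PE\<close> would enlarge the family.\<close>

lemma maximal_orth_family_atom:
  assumes A: "orth_family (A :: ('a \<Rightarrow> 'a) set)"
    and max: "\<And>A'. orth_family (A' :: ('a \<Rightarrow> 'a) set) \<Longrightarrow> card A' \<le> card A"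
    and P: "order_projection P" and E: "E \<in> A"
  shows "(\<forall>x. P (E x) = 0) \<or> (\<forall>x. P (E x) = E x)"
proof (rule ccontr)
  assume nt: "\<not> ?thesis"
  define F where "F = (\<lambda>x. P (E x))"
  define G where "G = (\<lambda>x. E x - P (E x))"
  note Ep = orth_familyD(2)[OF A E]
  have F: "order_projection F" "F \<noteq> (\<lambda>_. 0)"
    using order_projection_comp[OF P Ep] nt unfolding F_def by metis+
  have G: "order_projection G" "G \<noteq> (\<lambda>_. 0)"
    using order_projection_comp[OF order_projection_compl[OF P] Ep] nt
    unfolding G_def by (metis right_minus_eq)+
  have FG: "F (G x) = 0" for x
    unfolding F_def G_def
    by (simp add: order_projection_commute[OF Ep P, symmetric] order_projectionD(2)[OF P]
        linear_diff[OF order_projectionD(1)[OF P]] linear_diff[OF order_projectionD(1)[OF Ep]])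
  have orth: "F (Q x) = 0" "G (Q x) = 0" if "Q \<in> A" "Q \<noteq> E" for Q x
    using orth_familyD(4)[OF A E that(1)] that(2) linear_0[OF order_projectionD(1)[OF P]]
    by (auto simp: F_def G_def)
  have comm: "H (K x) = K (H x)" if "order_projection H" "order_projection K"
    for H K :: "'a \<Rightarrow> 'a" and x
    using order_projection_commute[OF that] .
  have orth': "Q (F x) = 0" "Q (G x) = 0" if "Q \<in> A" "Q \<noteq> E" for Q x
    using orth[OF that] comm[OF orth_familyD(2)[OF A that(1)]] F G by metis+
  have GF: "G (F x) = 0" for x using FG comm F G by metis
  have "F \<noteq> G" using FG F order_projectionD(2)[OF F(1)] by metis
  \<comment> \<open>\<open>F\<close> and \<open>G\<close> annihilate the ranges of the remaining
    members, so either one occurring among them would annihilate its own range and be zero.\<close>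
  have notin: "F \<notin> A - {E}" "G \<notin> A - {E}"
    using orth F G order_projectionD(2)[OF F(1)] order_projectionD(2)[OF G(1)] by (metis DiffE insertI1)+
  let ?A = "insert F (insert G (A - {E}))"
  have "orth_family ?A"
    unfolding orth_family_def
    using orth_familyD[OF A] F G FG GF orth orth' by auto
  then have "card ?A \<le> card A" by (rule max)
  moreover have "card ?A = Suc (Suc (card (A - {E})))"
    using notin \<open>F \<noteq> G\<close> orth_familyD(1)[OF A] by auto
  ultimately show False
    using E orth_familyD(1)[OF A] by (simp add: card_Diff_singleton_if)
qed

lemma bij_betw_subsets_order_projections:
  assumes A: "orth_family (A :: ('a \<Rightarrow> 'a) set)"
    and max: "\<And>A'. orth_family (A' :: ('a \<Rightarrow> 'a) set) \<Longrightarrow> card A' \<le> card A"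
  shows "bij_betw (\<lambda>T x. \<Sum>E\<in>T. E x) (Pow A) {P :: 'a \<Rightarrow> 'a. order_projection P}"
  unfolding bij_betw_def
proof (intro conjI equalityI subsetI)
  show "inj_on (\<lambda>T x. \<Sum>E\<in>T. E x) (Pow A)"
  proof (rule inj_onI)
    fix S T assume ST: "S \<in> Pow A" "T \<in> Pow A" and eq: "(\<lambda>x. \<Sum>E\<in>S. E x) = (\<lambda>x. \<Sum>E\<in>T. E x)"
    have "E \<in> S \<longleftrightarrow> E \<in> T" if E: "E \<in> A" for E
    proof -
      obtain x where "E x \<noteq> 0" using orth_familyD(3)[OF A E] by auto
      moreover have "(if E \<in> S then E x else 0) = (if E \<in> T then E x else 0)"
        using orth_family_apply_sum[OF A _ E, of S x] orth_family_apply_sum[OF A _ E, of T x] ST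
          fun_cong[OF eq, of x] by auto
      ultimately show ?thesis by (auto split: if_splits)
    qed
    then show "S = T" using ST by auto
  qed
next
  fix P assume "P \<in> (\<lambda>T x. \<Sum>E\<in>T. E x) ` Pow A"
  then show "P \<in> {P. order_projection P}" using orth_family_sum[OF A] by auto
next
  fix P :: "'a \<Rightarrow> 'a" assume "P \<in> {P. order_projection P}"
  then have P: "order_projection P" by simp
  \<comment> \<open>On the range of each atom \<open>P\<close> is the identity or zero;
    \<open>T\<close> collects the atoms of the first kind, and applying \<open>P\<close> to the
    expansion of \<open>x\<close> drops the others.\<close>
  define T where "T = {E \<in> A. \<forall>x. P (E x) = E x}"
  have "P = (\<lambda>x. \<Sum>E\<in>T. E x)"
  proof
    fix x
    have "P x = P (\<Sum>E\<in>A. E x)" by (simp add: maximal_orth_family_sum[OF A max])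
    also have "\<dots> = (\<Sum>E\<in>A. P (E x))" by (rule linear_sum[OF order_projectionD(1)[OF P]])
    also have "\<dots> = (\<Sum>E\<in>A. if \<forall>x. P (E x) = E x then E x else 0)"
      using maximal_orth_family_atom[OF A max P] by (intro sum.cong) auto
    also have "\<dots> = (\<Sum>E\<in>T. E x)"
      unfolding T_def using orth_familyD(1)[OF A] by (simp add: sum.inter_filter)
    finally show "P x = (\<Sum>E\<in>T. E x)" .
  qed
  moreover have "T \<in> Pow A" unfolding T_def by blast
  ultimately show "P \<in> (\<lambda>T x. \<Sum>E\<in>T. E x) ` Pow A" by blast
qed

lemma card_order_projections:
  assumes A: "orth_family (A :: ('a \<Rightarrow> 'a) set)"
    and max: "\<And>A'. orth_family (A' :: ('a \<Rightarrow> 'a) set) \<Longrightarrow> card A' \<le> card A"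
  shows "finite {P :: 'a \<Rightarrow> 'a. order_projection P}"
    "card {P :: 'a \<Rightarrow> 'a. order_projection P} = 2 ^ card A"
  using bij_betw_finite[OF bij_betw_subsets_order_projections[OF A max]]
    bij_betw_same_card[OF bij_betw_subsets_order_projections[OF A max]] orth_familyD(1)[OF A]
  by (simp_all add: card_Pow)

end

section \<open>Positive bases\<close>

text \<open>Up to isomorphism this is real coordinate space with its componentwise order, so both
  halves of the characterization meet here.\<close>

definition positive_basis :: "'a::ordered_real_vector set \<Rightarrow> bool"
  where "positive_basis D \<longleftrightarrow> finite D \<and> independent D \<and> span D = UNIV \<and>
    (\<forall>x. 0 \<le> x \<longleftrightarrow> (\<forall>u\<in>D. 0 \<le> real_vector.representation D x u))"

lemma representation_combination:
  fixes D :: "'a::real_vector set"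
  assumes "finite D" "independent D" "u \<in> D"
  shows "real_vector.representation D (\<Sum>v\<in>D. c v *\<^sub>R v) u = c u"
proof -
  have "real_vector.representation D (\<Sum>v\<in>D. c v *\<^sub>R v) u =
      (\<Sum>v\<in>D. real_vector.representation D (c v *\<^sub>R v) u)"
    using assms by (simp add: real_vector.representation_sum span_scale span_base)
  also have "\<dots> = (\<Sum>v\<in>D. if v = u then c u else 0)"
    using assms
    by (intro sum.cong)
      (auto simp: real_vector.representation_scale real_vector.representation_basis span_base)
  finally show ?thesis using assms by simp
qed

context
  fixes D :: "'a::ordered_real_vector set"
  assumes D: "positive_basis D"
begin

abbreviation (input) coord :: "'a \<Rightarrow> 'a \<Rightarrow> real"
  where "coord x u \<equiv> real_vector.representation D x u"

lemma positive_basis_facts: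
  "finite D" "independent D" "span D = UNIV" "0 \<le> x \<longleftrightarrow> (\<forall>u\<in>D. 0 \<le> coord x u)"
  using D unfolding positive_basis_def by blast+

lemma positive_basis_coord_linear: "linear (\<lambda>x. coord x u)"
  using positive_basis_facts
  by (intro linearI) (simp_all add: real_vector.representation_add real_vector.representation_scale)

lemma positive_basis_le_iff: "x \<le> y \<longleftrightarrow> (\<forall>u\<in>D. coord x u \<le> coord y u)"
  using positive_basis_facts(4)[of "y - x"] by (simp add: linear_diff[OF positive_basis_coord_linear])

lemma positive_basis_coord_combination:
  "u \<in> D \<Longrightarrow> coord (\<Sum>v\<in>D. c v *\<^sub>R v) u = c u"
  using positive_basis_facts by (intro representation_combination)

lemma positive_basis_archimedean: "archimedean TYPE('a)"
  unfolding archimedean_def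
proof (intro allI impI)
  fix x y :: 'a assume le: "\<forall>n::nat. 1 \<le> n \<longrightarrow> real n *\<^sub>R x \<le> y"
  have "coord x u \<le> 0" if u: "u \<in> D" for u
  proof (rule ccontr)
    assume "\<not> ?thesis"
    \<comment> \<open>This \<open>n\<close> may be 0, where the hypothesis says nothing; the
      instance at 1 below covers that case.\<close>
    then obtain n where "coord y u < real n * coord x u"
      using reals_Archimedean3[of "coord x u"] by auto
    moreover have "n \<noteq> 0 \<Longrightarrow> real n * coord x u \<le> coord y u"
      using le u by (auto simp: positive_basis_le_iff linear_scale[OF positive_basis_coord_linear])
    moreover have "coord x u \<le> coord y u"
      using le[rule_format, of 1] u by (auto simp: positive_basis_le_iff)
    ultimately show False using \<open>\<not> coord x u \<le> 0\<close> by (cases "n = 0") auto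
  qed
  then show "x \<le> 0"
    by (simp add: positive_basis_le_iff linear_0[OF positive_basis_coord_linear])
qed

lemma positive_basis_vector_lattice: "vector_lattice TYPE('a)"
  unfolding vector_lattice_def
proof (intro allI conjI)
  fix x y :: 'a
  show "\<exists>s. isLub UNIV {x, y} s"
    by (rule exI[of _ "\<Sum>u\<in>D. max (coord x u) (coord y u) *\<^sub>R u"])
      (simp add: isLub_pair positive_basis_le_iff positive_basis_coord_combination)
  show "\<exists>i. isGlb UNIV {x, y} i"
    by (rule exI[of _ "\<Sum>u\<in>D. min (coord x u) (coord y u) *\<^sub>R u"])
      (simp add: isGlb_pair positive_basis_le_iff positive_basis_coord_combination)
qed

lemma positive_basis_order_projection:
  assumes T: "T \<subseteq> D"
  shows "order_projection (\<lambda>x. \<Sum>u\<in>T. coord x u *\<^sub>R u)"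
proof -
  define P where "P = (\<lambda>x. \<Sum>u\<in>T. coord x u *\<^sub>R u)"
  \<comment> \<open>Padding with zero coefficients gives a sum over the whole basis, from which
    coordinates can be read off.\<close>
  have P_eq: "P x = (\<Sum>u\<in>D. (if u \<in> T then coord x u else 0) *\<^sub>R u)" for x
    unfolding P_def using T positive_basis_facts(1)
    by (intro sum.mono_neutral_cong_left) auto
  have coord_P: "coord (P x) u = (if u \<in> T then coord x u else 0)" if "u \<in> D" for x u
    unfolding P_eq by (rule positive_basis_coord_combination[OF that])
  have "linear P"
    unfolding P_def
    by (intro linearI)
      (simp_all add: linear_add[OF positive_basis_coord_linear]
        linear_scale[OF positive_basis_coord_linear] scaleR_add_left sum.distrib scaleR_sum_right)
  moreover have "P (P x) = P x" for x
    unfolding P_eq[of "P x"] by (subst P_eq[of x], intro sum.cong) (auto simp: coord_P)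
  moreover have "0 \<le> P x \<and> P x \<le> x" if "0 \<le> x" for x
    using that
    by (simp add: positive_basis_le_iff coord_P linear_0[OF positive_basis_coord_linear])
  ultimately show ?thesis unfolding order_projection_def P_def by blast
qed

text \<open>Coordinate projections for different subsets differ: at a basis vector \<open>u\<close>
  the value is \<open>u\<close> or 0 according to membership in the subset.\<close>

lemma positive_basis_card_order_projections:
  assumes "finite {P :: 'a \<Rightarrow> 'a. order_projection P}"
  shows "2 ^ card D \<le> card {P :: 'a \<Rightarrow> 'a. order_projection P}"
proof -
  let ?f = "\<lambda>T x. \<Sum>u\<in>T. coord x u *\<^sub>R u"
  have val: "?f T u = (if u \<in> T then u else 0)" if "T \<subseteq> D" "u \<in> D" for T u
  proof -
    have "?f T u = (\<Sum>v\<in>T. if v = u then u else 0)"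
      using that positive_basis_facts
      by (intro sum.cong) (auto simp: real_vector.representation_basis)
    then show ?thesis using finite_subset[OF that(1) positive_basis_facts(1)] by simp
  qed
  have "inj_on ?f (Pow D)"
  proof (rule inj_onI)
    fix S T assume ST: "S \<in> Pow D" "T \<in> Pow D" and "?f S = ?f T"
    then have "(if u \<in> S then u else 0) = (if u \<in> T then u else 0)" if "u \<in> D" for u
      using val that by (metis PowD)
    moreover have "0 \<notin> D" using positive_basis_facts(2) dependent_zero by blast
    ultimately have "u \<in> S \<longleftrightarrow> u \<in> T" if "u \<in> D" for u
      using that by (metis (full_types))
    then show "S = T" using ST by auto
  qed
  moreover have "?f ` Pow D \<subseteq> {P. order_projection P}"
    using positive_basis_order_projection by auto
  ultimately show ?thesis
    using card_inj_on_le[of ?f "Pow D"] assms positive_basis_facts(1) by (simp add: card_Pow)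
qed

end

text \<open>One positive vector \<open>e E\<close> from each range gives an independent family of
  full size. For positive \<open>x\<close>, \<open>E x\<close> is the coordinate of \<open>x\<close>
  times \<open>e E\<close>, and positivity of \<open>E x\<close> passes to the coordinate.\<close>

lemma (in finite_dim_directed_ovs) orth_family_positive_basis:
  assumes A: "orth_family (A :: ('a \<Rightarrow> 'a) set)" and card: "card A = dim (UNIV :: 'a set)"
  obtains D :: "'a set" where "positive_basis D"
proof -
  have "\<forall>E\<in>A. \<exists>e. 0 \<le> e \<and> e \<noteq> 0 \<and> E e = e"
    using order_projection_nonneg_fixed[OF orth_familyD(2,3)[OF A]] by blast
  then obtain e where pos: "\<And>E. E \<in> A \<Longrightarrow> 0 \<le> e E"
    and e: "\<And>E. E \<in> A \<Longrightarrow> e E \<noteq> 0" "\<And>E. E \<in> A \<Longrightarrow> E (e E) = e E" by metis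
  let ?D = "e ` A"
  have inj: "inj_on e A" and ind: "independent ?D"
    using orth_family_independent[OF A e] by auto
  have fin: "finite ?D" using orth_familyD(1)[OF A] by simp
  have span: "span ?D = UNIV"
    using finite_dim_independent_spans[OF finite_dim ind] card card_image[OF inj] by simp
  have expand: "(\<Sum>u\<in>?D. real_vector.representation ?D x u *\<^sub>R u) = x" for x
    using fin ind span by (intro real_vector.sum_representation_eq) auto
  have "0 \<le> x \<longleftrightarrow> (\<forall>u\<in>?D. 0 \<le> real_vector.representation ?D x u)" for x
  proof
    assume x: "0 \<le> x"
    show "\<forall>u\<in>?D. 0 \<le> real_vector.representation ?D x u"
    proof
      fix u assume "u \<in> ?D"
      then obtain E where E: "E \<in> A" "u = e E" by auto
      let ?c = "\<lambda>F. real_vector.representation ?D x (e F)"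
      note Ep = orth_familyD(2)[OF A E(1)]
      note lin = order_projectionD(1)[OF Ep]
      have "E x = E (\<Sum>F\<in>A. ?c F *\<^sub>R e F)"
        using expand[of x] by (simp add: sum.reindex[OF inj])
      also have "\<dots> = (\<Sum>F\<in>A. ?c F *\<^sub>R E (e F))"
        by (simp add: linear_sum[OF lin] linear_scale[OF lin])
      also have "\<dots> = (\<Sum>F\<in>A. if F = E then ?c E *\<^sub>R e E else 0)"
        using orth_familyD(4)[OF A E(1)] e by (intro sum.cong) (auto, metis)
      also have "\<dots> = ?c E *\<^sub>R e E" using E orth_familyD(1)[OF A] by simp
      finally have nonneg: "0 \<le> ?c E *\<^sub>R e E" using order_projectionD(3)[OF Ep x] by simp
      show "0 \<le> real_vector.representation ?D x u"
      proof (rule ccontr)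
        assume neg: "\<not> ?thesis"
        then have "?c E *\<^sub>R e E \<le> 0"
          using pos[OF E(1)] E by (intro scaleR_nonpos_nonneg) auto
        then have "?c E *\<^sub>R e E = 0" using nonneg by simp
        then show False using neg e(1) E by auto
      qed
    qed
  next
    assume nn: "\<forall>u\<in>?D. 0 \<le> real_vector.representation ?D x u"
    have "0 \<le> (\<Sum>u\<in>?D. real_vector.representation ?D x u *\<^sub>R u)"
      using nn pos by (intro sum_nonneg scaleR_nonneg_nonneg) auto
    then show "0 \<le> x" by (simp add: expand)
  qed
  then have "positive_basis ?D"
    unfolding positive_basis_def using fin ind span by blast
  then show ?thesis using that by blast
qed

section \<open>Archimedean vector lattices of finite dimension\<close>

text \<open>For positive \<open>u\<close> and \<open>v\<close> this says that their infimum is 0,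
  the usual lattice disjointness, without naming an infimum.\<close>

definition zero_meet :: "'a::ordered_real_vector \<Rightarrow> 'a \<Rightarrow> bool"
  where "zero_meet u v \<longleftrightarrow> (\<forall>z. z \<le> u \<longrightarrow> z \<le> v \<longrightarrow> z \<le> 0)"

lemma zero_meet_commute: "zero_meet u v \<longleftrightarrow> zero_meet v u"
  by (auto simp: zero_meet_def)

lemma zero_meet_mono: "zero_meet u v \<Longrightarrow> a \<le> u \<Longrightarrow> b \<le> v \<Longrightarrow> zero_meet a b"
  unfolding zero_meet_def by (meson order_trans)

lemma zero_meet_le: "zero_meet u v \<Longrightarrow> u \<le> v \<Longrightarrow> u \<le> 0"
  unfolding zero_meet_def by blast

text \<open>The positive part \<open>s\<close> of a common lower bound lies below \<open>u\<close>
  and \<open>v + w\<close>. Then \<open>s - w\<close> lies below \<open>u\<close> and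
  \<open>v\<close>, so \<open>s \<le> w\<close>, and disjointness from \<open>w\<close>
  finishes.\<close>

lemma zero_meet_add:
  fixes u v w :: "'a::ordered_real_vector"
  assumes "vector_lattice TYPE('a)"
    and uv: "zero_meet u v" and uw: "zero_meet u w" and nn: "0 \<le> u" "0 \<le> v" "0 \<le> w"
  shows "zero_meet u (v + w)"
  unfolding zero_meet_def
proof (intro allI impI)
  fix z assume z: "z \<le> u" "z \<le> v + w"
  obtain s where s: "z \<le> s" "0 \<le> s" and least: "\<And>t. z \<le> t \<Longrightarrow> 0 \<le> t \<Longrightarrow> s \<le> t"
    using assms(1) isLub_pair[of z 0] unfolding vector_lattice_def by metis
  have su: "s \<le> u" using least z nn by blast
  have "s \<le> v + w" using least z nn by (simp add: add_nonneg_nonneg)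
  then have "s - w \<le> v" by (simp add: diff_le_eq)
  moreover have "s - w \<le> u" using su nn(3) by (meson diff_le_eq le_add_same_cancel1 order_trans)
  ultimately have "s - w \<le> 0" using uv unfolding zero_meet_def by blast
  then have "s \<le> w" by simp
  then have "s \<le> 0" using su uw unfolding zero_meet_def by blast
  then show "z \<le> 0" using s by simp
qed

lemma zero_meet_scale:
  fixes u v :: "'a::ordered_real_vector"
  assumes uv: "zero_meet u v" and nn: "0 \<le> u" "0 \<le> v" and c: "0 \<le> c"
  shows "zero_meet u (c *\<^sub>R v)"
  unfolding zero_meet_def
proof (intro allI impI)
  fix z assume z: "z \<le> u" "z \<le> c *\<^sub>R v"
  \<comment> \<open>Dividing by a number that is at least \<open>c\<close> and at least 1 brings the
    bound \<open>c v\<close> down to \<open>v\<close> and keeps \<open>z\<close> below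
    \<open>u\<close>.\<close>
  let ?d = "max 1 c"
  have "z \<le> ?d *\<^sub>R v"
    using z(2) scaleR_right_mono[of c ?d v] nn by simp
  then have "inverse ?d *\<^sub>R z \<le> inverse ?d *\<^sub>R (?d *\<^sub>R v)"
    by (intro scaleR_left_mono) auto
  then have "inverse ?d *\<^sub>R z \<le> v" by simp
  moreover have "inverse ?d *\<^sub>R z \<le> inverse ?d *\<^sub>R u"
    using z(1) by (intro scaleR_left_mono) auto
  moreover have "inverse ?d *\<^sub>R u \<le> 1 *\<^sub>R u"
    using nn by (intro scaleR_right_mono) (auto simp: inverse_eq_divide)
  ultimately have "inverse ?d *\<^sub>R z \<le> 0"
    using uv unfolding zero_meet_def by (metis order_trans scaleR_one)
  then have "?d *\<^sub>R (inverse ?d *\<^sub>R z) \<le> ?d *\<^sub>R 0"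
    by (intro scaleR_left_mono) auto
  then show "z \<le> 0" by simp
qed

text \<open>\<open>a\<close> and \<open>b\<close> are the positive and negative parts. If
  \<open>z\<close> lies below both, then \<open>a - z\<close> still bounds \<open>y\<close> and 0,
  so minimality of \<open>a\<close> gives \<open>z \<le> 0\<close>.\<close>

lemma vector_lattice_decomp:
  fixes y :: "'a::ordered_real_vector"
  assumes "vector_lattice TYPE('a)"
  obtains a b where "0 \<le> a" "0 \<le> b" "y = a - b" "zero_meet a b"
    "\<And>t. 0 \<le> t \<Longrightarrow> y \<le> t \<Longrightarrow> a \<le> t" "\<And>t. 0 \<le> t \<Longrightarrow> - y \<le> t \<Longrightarrow> b \<le> t"
proof -
  obtain s where s: "y \<le> s" "0 \<le> s" and least: "\<And>t. y \<le> t \<Longrightarrow> 0 \<le> t \<Longrightarrow> s \<le> t"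
    using assms(1) isLub_pair[of y 0] unfolding vector_lattice_def by metis
  have "zero_meet s (s - y)"
    unfolding zero_meet_def
  proof (intro allI impI)
    fix z assume "z \<le> s" "z \<le> s - y"
    then have "s \<le> s - z" by (intro least) (simp_all add: algebra_simps)
    then show "z \<le> 0" by simp
  qed
  moreover have "s - y \<le> t" if "0 \<le> t" "- y \<le> t" for t
    using least[of "t + y"] that add_left_mono[OF that(2), of y] by (simp add: algebra_simps)
  ultimately show ?thesis
    using that[of s "s - y"] s least by simp
qed

section \<open>Families of pairwise disjoint positive vectors\<close>

definition disjoint_family :: "'a::ordered_real_vector set \<Rightarrow> bool"
  where "disjoint_family D \<longleftrightarrow> finite D \<and> (\<forall>u\<in>D. 0 \<le> u \<and> u \<noteq> 0) \<and>
    (\<forall>u\<in>D. \<forall>v\<in>D. u \<noteq> v \<longrightarrow> zero_meet u v)"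

lemma disjoint_familyD:
  assumes "disjoint_family D"
  shows "finite D" "u \<in> D \<Longrightarrow> 0 \<le> u" "u \<in> D \<Longrightarrow> u \<noteq> 0"
    "u \<in> D \<Longrightarrow> v \<in> D \<Longrightarrow> u \<noteq> v \<Longrightarrow> zero_meet u v"
  using assms by (auto simp: disjoint_family_def)

lemma zero_meet_sum:
  fixes u :: "'a::ordered_real_vector"
  assumes "vector_lattice TYPE('a)" "finite F" "0 \<le> u"
    and "\<And>v. v \<in> F \<Longrightarrow> 0 \<le> f v \<and> zero_meet u (f v)"
  shows "zero_meet u (\<Sum>v\<in>F. f v)"
  using assms(2,4)
proof (induction F rule: finite_induct)
  case empty
  then show ?case by (simp add: zero_meet_def)
next
  case (insert v F)
  then have "zero_meet u (f v + (\<Sum>v\<in>F. f v))"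
    by (intro zero_meet_add assms sum_nonneg) auto
  then show ?case using insert by simp
qed

text \<open>In a linear relation, a term with positive coefficient would lie below a positive
  combination of the other vectors, from which it is disjoint, and so be zero.\<close>

lemma disjoint_family_independent:
  fixes D :: "'a::ordered_real_vector set"
  assumes VL: "vector_lattice TYPE('a)" and D: "disjoint_family D"
  shows "independent D"
proof (rule independent_if_scalars_zero)
  show fin: "finite D" using disjoint_familyD(1)[OF D] .
  \<comment> \<open>Stated for arbitrary coefficients so that it can be applied to
    \<open>- f\<close> as well.\<close>
  have nonpos: "f u \<le> 0" if sum: "(\<Sum>x\<in>D. f x *\<^sub>R x) = 0" and u: "u \<in> D" for f u
  proof (rule ccontr)
    assume f: "\<not> f u \<le> 0"
    let ?w = "\<Sum>v\<in>D - {u}. max 0 (- f v) *\<^sub>R v"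
    have nn: "0 \<le> f u *\<^sub>R u" using f disjoint_familyD(2)[OF D u] by (intro scaleR_nonneg_nonneg) auto
    have "f u *\<^sub>R u = (\<Sum>v\<in>D - {u}. (- f v) *\<^sub>R v)"
      using sum sum.remove[OF fin u, of "\<lambda>x. f x *\<^sub>R x"]
      by (simp add: sum_negf eq_neg_iff_add_eq_0)
    also have "\<dots> \<le> ?w"
      using disjoint_familyD(2)[OF D] by (intro sum_mono scaleR_right_mono) auto
    finally have le: "f u *\<^sub>R u \<le> ?w" .
    have "zero_meet (f u *\<^sub>R u) ?w"
    proof (rule zero_meet_sum[OF VL])
      fix v assume v: "v \<in> D - {u}"
      have "zero_meet u (max 0 (- f v) *\<^sub>R v)"
        using disjoint_familyD[OF D] u v by (intro zero_meet_scale) auto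
      then have "zero_meet (max 0 (- f v) *\<^sub>R v) (f u *\<^sub>R u)"
        using disjoint_familyD[OF D] u v f
        by (intro zero_meet_scale) (auto simp: zero_meet_commute intro: scaleR_nonneg_nonneg)
      then show "0 \<le> max 0 (- f v) *\<^sub>R v \<and> zero_meet (f u *\<^sub>R u) (max 0 (- f v) *\<^sub>R v)"
        using disjoint_familyD(2)[OF D] v
        by (auto simp: zero_meet_commute intro!: scaleR_nonneg_nonneg)
    qed (use fin nn in auto)
    then have "f u *\<^sub>R u \<le> 0" using le zero_meet_le by blast
    then have "f u *\<^sub>R u = 0" using nn by simp
    then show False using f disjoint_familyD(3)[OF D u] by simp
  qed
  fix f u assume sum: "(\<Sum>x\<in>D. f x *\<^sub>R x) = 0" and u: "u \<in> D"
  have "f u \<le> 0" using nonpos[OF sum u] .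
  moreover have "- f u \<le> 0" using nonpos[of "\<lambda>x. - f x"] sum u by (simp add: sum_negf)
  ultimately show "f u = 0" by simp
qed

section \<open>The Archimedean property and multiples of an atom\<close>

lemma archimedean_small:
  fixes x y :: "'a::ordered_real_vector"
  assumes arch: "archimedean TYPE('a)" and small: "\<And>e. 0 < e \<Longrightarrow> x \<le> e *\<^sub>R y"
  shows "x \<le> 0"
proof -
  have "real n *\<^sub>R x \<le> y" if "1 \<le> n" for n :: nat
  proof -
    have "x \<le> (1 / real n) *\<^sub>R y" using small that by simp
    then have "real n *\<^sub>R x \<le> real n *\<^sub>R ((1 / real n) *\<^sub>R y)" by (intro scaleR_left_mono) auto
    then show ?thesis using that by simp
  qed
  then show ?thesis using arch unfolding archimedean_def by blast
qed

text \<open>The admissible \<open>t\<close> are bounded, since otherwise every integer multiple of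
  \<open>u\<close> would lie below \<open>x\<close>. Their supremum \<open>c\<close> is attained
  because \<open>c u - x\<close> lies below every positive multiple of \<open>u\<close>.\<close>

lemma archimedean_largest_multiple:
  fixes x u :: "'a::ordered_real_vector"
  assumes arch: "archimedean TYPE('a)" and u: "0 \<le> u" "u \<noteq> 0" and x: "0 \<le> x"
  obtains c where "0 \<le> c" "c *\<^sub>R u \<le> x" "\<And>t. t *\<^sub>R u \<le> x \<Longrightarrow> t \<le> c"
proof -
  let ?S = "{t. t *\<^sub>R u \<le> x}"
  have down: "s *\<^sub>R u \<le> x" if "t *\<^sub>R u \<le> x" "s \<le> t" for s t
    using that scaleR_right_mono[OF that(2) u(1)] by simp
  have bdd: "bdd_above ?S"
  proof (rule ccontr)
    assume nb: "\<not> bdd_above ?S"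
    have "real n *\<^sub>R u \<le> x" for n :: nat
    proof -
      obtain t where "t \<in> ?S" "real n < t"
        using nb unfolding bdd_above_def by (meson not_less)
      then show ?thesis using down by auto
    qed
    then have "u \<le> 0" using arch unfolding archimedean_def by blast
    then show False using u by simp
  qed
  have zero: "0 \<in> ?S" using x by simp
  define c where "c = Sup ?S"
  have ub: "t \<le> c" if "t *\<^sub>R u \<le> x" for t
    unfolding c_def using that bdd by (intro cSup_upper) auto
  have "c *\<^sub>R u - x \<le> 0"
  proof (rule archimedean_small[OF arch])
    fix e :: real assume "0 < e"
    then obtain t where "t \<in> ?S" "c - e < t"
      using less_cSup_iff[of ?S "c - e"] bdd zero unfolding c_def by (metis diff_less_eq empty_iff less_add_same_cancel1)
    then have "(c - e) *\<^sub>R u \<le> x" using down by auto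
    then show "c *\<^sub>R u - x \<le> e *\<^sub>R u" by (simp add: algebra_simps)
  qed
  then show ?thesis using that[of c] ub zero by auto
qed

text \<open>Inside an atom any multiple of \<open>u\<close> is comparable with \<open>y\<close>, since the positive and negative
  parts of \<open>y - t u\<close> are disjoint and dominated by \<open>u\<close>.\<close>

lemma lattice_atom_multiple:
  fixes y u :: "'a::ordered_real_vector"
  assumes VL: "vector_lattice TYPE('a)" and arch: "archimedean TYPE('a)"
    and atom: "\<And>a b. 0 \<le> a \<Longrightarrow> a \<le> u \<Longrightarrow> 0 \<le> b \<Longrightarrow> b \<le> u \<Longrightarrow> zero_meet a b \<Longrightarrow> a = 0 \<or> b = 0"
    and u: "u \<noteq> 0" and y: "0 \<le> y" "y \<le> u"
  obtains c where "0 \<le> c" "y = c *\<^sub>R u"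
proof -
  have u0: "0 \<le> u" using y by simp
  obtain c where c: "0 \<le> c" "c *\<^sub>R u \<le> y" and ub: "\<And>t. t *\<^sub>R u \<le> y \<Longrightarrow> t \<le> c"
    using archimedean_largest_multiple[OF arch u0 u y(1)] by blast
  \<comment> \<open>Only \<open>t < 1\<close> needs the atom hypothesis: there
    \<open>t u \<le> u\<close>, so both parts of \<open>y - t u\<close> lie below \<open>u\<close>.
    A vanishing negative part would contradict the maximality of \<open>c\<close>. Letting
    \<open>t\<close> decrease to \<open>c\<close> then gives \<open>y \<le> c u\<close>.\<close>
  have above: "y \<le> t *\<^sub>R u" if t: "c < t" for t
  proof (cases "1 \<le> t")
    case True
    then have "1 *\<^sub>R u \<le> t *\<^sub>R u" using u0 by (intro scaleR_right_mono)
    then show ?thesis using y by simp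
  next
    case False
    obtain a b where ab: "0 \<le> a" "0 \<le> b" "y - t *\<^sub>R u = a - b" "zero_meet a b"
      and a: "\<And>s. 0 \<le> s \<Longrightarrow> y - t *\<^sub>R u \<le> s \<Longrightarrow> a \<le> s"
      and b: "\<And>s. 0 \<le> s \<Longrightarrow> - (y - t *\<^sub>R u) \<le> s \<Longrightarrow> b \<le> s"
      using vector_lattice_decomp[OF VL] by blast
    have tu: "0 \<le> t *\<^sub>R u" "t *\<^sub>R u \<le> u"
      using t c(1) u0 scaleR_right_mono[of t 1 u] False by (auto intro: scaleR_nonneg_nonneg)
    have "a \<le> u" using a[OF u0] tu y by (meson diff_le_eq le_add_same_cancel1 order_trans)
    moreover have "b \<le> u"
      using b[OF u0] tu y by (simp add: diff_le_eq) (meson le_add_same_cancel1 order_trans)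
    ultimately consider "a = 0" | "b = 0" using atom ab by blast
    then show ?thesis
    proof cases
      case 1
      then show ?thesis using ab(2,3) by (metis diff_0 diff_le_0_iff_le neg_le_0_iff_le)
    next
      case 2
      then have "t *\<^sub>R u \<le> y" using ab(1,3) by (metis diff_ge_0_iff_ge diff_zero)
      then show ?thesis using ub t by fastforce
    qed
  qed
  have "y - c *\<^sub>R u \<le> 0"
  proof (rule archimedean_small[OF arch])
    fix e :: real assume "0 < e"
    then show "y - c *\<^sub>R u \<le> e *\<^sub>R u" using above[of "c + e"] by (simp add: algebra_simps)
  qed
  then show ?thesis using that[of c] c by simp
qed

text \<open>Remove the largest multiple \<open>c u\<close> below \<open>x\<close>. The infimum of
  the rest with \<open>u\<close> is again a multiple \<open>s u\<close>, and
  \<open>(c + s) u \<le> x\<close> forces \<open>s = 0\<close>.\<close>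

lemma lattice_atom_component:
  fixes x u :: "'a::ordered_real_vector"
  assumes VL: "vector_lattice TYPE('a)" and arch: "archimedean TYPE('a)"
    and atom: "\<And>a b. 0 \<le> a \<Longrightarrow> a \<le> u \<Longrightarrow> 0 \<le> b \<Longrightarrow> b \<le> u \<Longrightarrow> zero_meet a b \<Longrightarrow> a = 0 \<or> b = 0"
    and u: "0 \<le> u" "u \<noteq> 0" and x: "0 \<le> x"
  obtains c where "0 \<le> c" "c *\<^sub>R u \<le> x" "zero_meet (x - c *\<^sub>R u) u"
proof -
  obtain c where c: "0 \<le> c" "c *\<^sub>R u \<le> x" and ub: "\<And>t. t *\<^sub>R u \<le> x \<Longrightarrow> t \<le> c"
    using archimedean_largest_multiple[OF arch u x] by blast
  obtain i where i: "i \<le> x - c *\<^sub>R u" "i \<le> u"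
    and greatest: "\<And>z. z \<le> x - c *\<^sub>R u \<Longrightarrow> z \<le> u \<Longrightarrow> z \<le> i"
    using VL isGlb_pair[of "x - c *\<^sub>R u" u] unfolding vector_lattice_def by metis
  have "0 \<le> i" using greatest c u by simp
  then obtain s where s: "0 \<le> s" "i = s *\<^sub>R u"
    using lattice_atom_multiple[OF VL arch atom u(2) _ i(2)] by blast
  have "(c + s) *\<^sub>R u \<le> x" using i(1) s by (simp add: algebra_simps)
  then have "i = 0" using ub[of "c + s"] s by simp
  then show ?thesis using that c greatest unfolding zero_meet_def by blast
qed

text \<open>Replacing \<open>u\<close> by two nonzero disjoint vectors below it would give a larger
  disjoint family. This supplies the atom hypothesis for members of a maximal family.\<close>

lemma disjoint_family_refine:
  fixes D :: "'a::ordered_real_vector set"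
  assumes D: "disjoint_family D" and max: "\<forall>D'::'a set. disjoint_family D' \<longrightarrow> card D' \<le> card D"
    and u: "u \<in> D" and a: "0 \<le> a" "a \<le> u" and b: "0 \<le> b" "b \<le> u" and ab: "zero_meet a b"
  shows "a = 0 \<or> b = 0"
proof (rule ccontr)
  assume nz: "\<not> ?thesis"
  let ?D = "insert a (insert b (D - {u}))"
  have meet: "zero_meet a v" "zero_meet b v" if "v \<in> D - {u}" for v
    using that disjoint_familyD(4)[OF D u] a b by (blast intro: zero_meet_mono)+
  have "a \<noteq> b" using ab zero_meet_le nz a by (metis order_antisym order_refl)
  moreover have "a \<notin> D - {u}" "b \<notin> D - {u}"
    using meet zero_meet_le nz a b by (metis order_antisym order_refl)+
  ultimately have "card ?D = Suc (Suc (card (D - {u})))"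
    using disjoint_familyD(1)[OF D] by auto
  moreover have "disjoint_family ?D"
    unfolding disjoint_family_def
    using disjoint_familyD[OF D] a b ab nz meet by (auto simp: zero_meet_commute)
  then have "card ?D \<le> card D" using max by blast
  ultimately show False
    using u disjoint_familyD(1)[OF D] by (simp add: card_Diff_singleton_if)
qed

text \<open>Components along the members are subtracted one at a time. The final remainder is
  positive and disjoint from all members, so by maximality it is zero.\<close>

lemma disjoint_family_expansion:
  fixes D :: "'a::ordered_real_vector set"
  assumes VL: "vector_lattice TYPE('a)" and arch: "archimedean TYPE('a)"
    and D: "disjoint_family D" and max: "\<forall>D'::'a set. disjoint_family D' \<longrightarrow> card D' \<le> card D"
    and x: "0 \<le> x"
  obtains c where "\<And>u. u \<in> D \<Longrightarrow> 0 \<le> c u" "x = (\<Sum>u\<in>D. c u *\<^sub>R u)"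
proof -
  have "\<exists>c. (\<forall>u\<in>F. 0 \<le> c u) \<and> (\<Sum>u\<in>F. c u *\<^sub>R u) \<le> x \<and>
      (\<forall>v\<in>F. zero_meet (x - (\<Sum>u\<in>F. c u *\<^sub>R u)) v)" if "finite F" "F \<subseteq> D" for F
    using that
  proof (induction F rule: finite_induct)
    case empty
    then show ?case using x by simp
  next
    case (insert u F)
    then obtain c where c: "\<forall>u\<in>F. 0 \<le> c u" "(\<Sum>u\<in>F. c u *\<^sub>R u) \<le> x"
      "\<forall>v\<in>F. zero_meet (x - (\<Sum>u\<in>F. c u *\<^sub>R u)) v" by auto
    define y where "y = x - (\<Sum>u\<in>F. c u *\<^sub>R u)"
    have u: "u \<in> D" using insert by simp
    have "0 \<le> y" using c by (simp add: y_def)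
    then obtain d where d: "0 \<le> d" "d *\<^sub>R u \<le> y" "zero_meet (y - d *\<^sub>R u) u"
      using lattice_atom_component[OF VL arch disjoint_family_refine[OF D max u]
          disjoint_familyD(2,3)[OF D u]] by blast
    have "0 \<le> d *\<^sub>R u" using d disjoint_familyD(2)[OF D u] by (intro scaleR_nonneg_nonneg)
    then have le: "y - d *\<^sub>R u \<le> y" by simp
    have sum: "(\<Sum>v\<in>insert u F. (c(u := d)) v *\<^sub>R v) = d *\<^sub>R u + (\<Sum>v\<in>F. c v *\<^sub>R v)"
      using insert by (simp add: sum.insert) (intro sum.cong, auto)
    then have rest: "x - (\<Sum>v\<in>insert u F. (c(u := d)) v *\<^sub>R v) = y - d *\<^sub>R u"
      by (simp add: y_def algebra_simps)
    \<comment> \<open>The remainder only shrinks, so disjointness from the members already treated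
      persists.\<close>
    have "zero_meet (y - d *\<^sub>R u) v" if "v \<in> F" for v
      using c(3) that zero_meet_mono[OF _ le order_refl] y_def by blast
    then have "\<forall>v\<in>insert u F. zero_meet (x - (\<Sum>v\<in>insert u F. (c(u := d)) v *\<^sub>R v)) v"
      using d unfolding rest by blast
    moreover have "(\<Sum>v\<in>insert u F. (c(u := d)) v *\<^sub>R v) \<le> x"
      using rest d by (metis diff_ge_0_iff_ge)
    moreover have "\<forall>v\<in>insert u F. 0 \<le> (c(u := d)) v" using c d by simp
    ultimately show ?case by blast
  qed
  then obtain c where c: "\<forall>u\<in>D. 0 \<le> c u" "(\<Sum>u\<in>D. c u *\<^sub>R u) \<le> x"
    "\<forall>v\<in>D. zero_meet (x - (\<Sum>u\<in>D. c u *\<^sub>R u)) v"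
    using disjoint_familyD(1)[OF D] by blast
  define y where "y = x - (\<Sum>u\<in>D. c u *\<^sub>R u)"
  have "y = 0"
  proof (rule ccontr)
    assume nz: "y \<noteq> 0"
    have y: "0 \<le> y" "\<forall>v\<in>D. zero_meet y v" using c by (simp_all add: y_def)
    then have "y \<notin> D" using nz zero_meet_le by (metis order_antisym order_refl)
    moreover have "disjoint_family (insert y D)"
      using D y nz unfolding disjoint_family_def by (auto simp: zero_meet_commute)
    ultimately show False using max[rule_format, of "insert y D"] disjoint_familyD(1)[OF D] by simp
  qed
  then show ?thesis using that[of c] c(1) by (simp add: y_def)
qed

text \<open>Independence bounds the size of disjoint families, so a maximal one exists. It spans
  because every vector is a difference of positive ones, and uniqueness of coefficients turns the
  nonnegative expansions into nonnegative coordinates.\<close>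

lemma archimedean_vector_lattice_positive_basis:
  assumes VL: "vector_lattice TYPE('a::ordered_real_vector)" and arch: "archimedean TYPE('a)"
    and fd: "finite_dim TYPE('a)"
  obtains D :: "'a::ordered_real_vector set" where "positive_basis D"
proof -
  have "disjoint_family ({} :: 'a set)" by (simp add: disjoint_family_def)
  moreover have "\<forall>D. disjoint_family (D :: 'a set) \<longrightarrow> card D < Suc (dim (UNIV :: 'a set))"
    using finite_dim_independent_card_le(2)[OF fd disjoint_family_independent[OF VL]]
    by (simp add: less_Suc_eq_le)
  ultimately obtain D where D: "disjoint_family (D :: 'a set)"
    and max: "\<forall>D'::'a set. disjoint_family D' \<longrightarrow> card D' \<le> card D"
    using ex_has_greatest_nat[of disjoint_family "{} :: 'a set" card] by blast
  have fin: "finite D" and ind: "independent D"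
    using disjoint_familyD(1)[OF D] disjoint_family_independent[OF VL D] by auto
  note expansion = disjoint_family_expansion[OF VL arch D max]
  have pos: "x \<in> span D" if x: "0 \<le> x" for x
  proof -
    obtain c where "x = (\<Sum>u\<in>D. c u *\<^sub>R u)" using expansion[OF x] by blast
    then show ?thesis by (simp add: span_sum span_scale span_base)
  qed
  have "x \<in> span D" for x
  proof -
    obtain a b where "0 \<le> a" "0 \<le> b" "x = a - b"
      using vector_lattice_decomp[OF VL, of x] by metis
    then show ?thesis using pos span_diff by blast
  qed
  then have span: "span D = UNIV" by blast
  have "0 \<le> x \<longleftrightarrow> (\<forall>u\<in>D. 0 \<le> real_vector.representation D x u)" for x
  proof
    assume x: "0 \<le> x"
    obtain c where "\<And>u. u \<in> D \<Longrightarrow> 0 \<le> c u" "x = (\<Sum>u\<in>D. c u *\<^sub>R u)" using expansion[OF x] by blast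
    then show "\<forall>u\<in>D. 0 \<le> real_vector.representation D x u"
      using representation_combination[OF fin ind] by simp
  next
    assume nn: "\<forall>u\<in>D. 0 \<le> real_vector.representation D x u"
    have "0 \<le> (\<Sum>u\<in>D. real_vector.representation D x u *\<^sub>R u)"
      using nn disjoint_familyD(2)[OF D] by (intro sum_nonneg scaleR_nonneg_nonneg) auto
    then show "0 \<le> x" using fin ind span by (simp add: real_vector.sum_representation_eq)
  qed
  then show ?thesis
    using that[of D] fin ind span unfolding positive_basis_def by blast
qed

section \<open>Counting band projections\<close>

text \<open>If some finite set had no upper bound, the defining condition would make every vector
  positive, in particular \<open>- x\<close>, so that \<open>0\<close> is an upper bound after all.\<close>

lemma pre_Riesz_symmetric_bound:
  fixes x :: "'a::ordered_real_vector"
  assumes "pre_Riesz TYPE('a)"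
  shows "\<exists>z. x \<le> z \<and> - x \<le> z"
proof (rule ccontr)
  assume no: "\<not> ?thesis"
  have "0 \<le> y" for y :: 'a
  proof -
    \<comment> \<open>The set is chosen so that its translate by \<open>y\<close> is
      \<open>{x, - x}\<close>, which has no upper bound by assumption; the required inclusion is
      then vacuous.\<close>
    have "(+) y ` {x - y, - x - y} = {x, - x}" by simp
    then have "ubs UNIV ((+) y ` {x - y, - x - y}) \<subseteq> ubs UNIV {x - y, - x - y}"
      using no by (auto simp: mem_ubs_pair)
    then show ?thesis
      using assms unfolding pre_Riesz_def
      by (metis finite.emptyI finite.insertI insert_not_empty)
  qed
  from this[of "- x"] this[of x] have "x \<le> 0" "- x \<le> 0" by simp_all
  then show False using no by blast
qed

theorem theorem4p6:
  fixes n :: nat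
  assumes "pre_Riesz TYPE('a::ordered_real_vector)"
    and "finite_dim TYPE('a)"
    and "n = dim (UNIV :: 'a set)"
  shows "(\<exists>m\<in>{0..n}. finite {P :: 'a \<Rightarrow> 'a. band_projection P} \<and>
            card {P :: 'a \<Rightarrow> 'a. band_projection P} = 2 ^ m) \<and>
         (\<forall>m. card {P :: 'a \<Rightarrow> 'a. band_projection P} = 2 ^ m \<longrightarrow>
            (m = n \<longleftrightarrow> archimedean TYPE('a) \<and> vector_lattice TYPE('a)))"
proof -
  interpret finite_dim_directed_ovs "TYPE('a)"
    using pre_Riesz_symmetric_bound[OF assms(1)] assms(2) by unfold_locales
  obtain A where A: "orth_family (A :: ('a \<Rightarrow> 'a) set)"
    and max: "\<And>A'. orth_family (A' :: ('a \<Rightarrow> 'a) set) \<Longrightarrow> card A' \<le> card A"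
    using obtain_maximal_orth_family by blast
  have fin: "finite {P :: 'a \<Rightarrow> 'a. band_projection P}"
    and card: "card {P :: 'a \<Rightarrow> 'a. band_projection P} = 2 ^ card A"
    using card_order_projections[OF A max] by (simp_all add: band_projection_iff_order_projection)
  have le: "card A \<le> n" using orth_family_card_le[OF A] assms(3) by simp
  have "card A = n \<longleftrightarrow> archimedean TYPE('a) \<and> vector_lattice TYPE('a)"
  proof
    assume "card A = n"
    then obtain D :: "'a set" where "positive_basis D"
      using orth_family_positive_basis[OF A] assms(3) by blast
    then show "archimedean TYPE('a) \<and> vector_lattice TYPE('a)"
      using positive_basis_archimedean positive_basis_vector_lattice by blast
  next
    assume "archimedean TYPE('a) \<and> vector_lattice TYPE('a)"
    then obtain D :: "'a set" where D: "positive_basis D"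
      using archimedean_vector_lattice_positive_basis assms(2) by blast
    have "card D = n"
      using positive_basis_facts[OF D] assms(3) dim_span_eq_card_independent[of D] by simp
    \<comment> \<open>The coordinate projections number \<open>2 ^ n\<close> and are among the
      \<open>2 ^ card A\<close> order projections, so \<open>n \<le> card A\<close>.\<close>
    moreover have "(2::nat) ^ card D \<le> 2 ^ card A"
      using positive_basis_card_order_projections[OF D] card_order_projections[OF A max] by simp
    ultimately show "card A = n" using le by simp
  qed
  \<comment> \<open>Powers of 2 determine their exponents, so any \<open>m\<close> in the second
    claim equals \<open>card A\<close>.\<close>
  then show ?thesis using fin card le by (auto intro!: bexI[of _ "card A"])
qed

end
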